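(* Suppose Assumption 1 (stated in the context) holds, $p_1>\alpha$ and $p_2>1$. Then for every $({\sigma^1}^*,{\sigma^2}^* )\in\mathcal{S}_\Gamma$ and every attack $\mu\in\operatorname{supp}({\sigma^2}^* )$: $$C_2(\mu)\le C_2(\mu^{min})=\Theta,$$ and for every $(i,j)\in\mathcal{E}$, if $\mu_{ij}=1$ then $x^*_{ij}=c_{ij}$ for all $x^*\in\Omega$. Here $\mu^{min}$ is the attack disrupting exactly the edges of a min-cut.
   Context: Network. $\mathcal{G}=(\mathcal{V},\mathcal{E})$ is a finite directed graph with source $s$ and destination $t\neq s$, having at least one $s$-$t$ path; each edge $(i,j)$ has a capacity $c_{ij}>0$ and a unit transportation cost $b_{ij}>0$. $\Lambda_{path}$ is the set of (simple directed) $s$-$t$ paths and $\Lambda$ is the set of all $s$-$t$ paths and all loops (simple directed cycles). A feasible flow $x$ is given by nonnegative amounts $(x_\lambda)_{\lambda\in\Lambda}$ whose edge flows $x_{ij}=\sum_{\lambda\in\Lambda:(i,j)\in\lambda}x_\lambda$ satisfy $x_{ij}\le c_{ij}$ for all $(i,j)\in\mathcal{E}$; $\mathcal{F}$ is the set of feasible flows. $F(x)=\sum_{\lambda\in\Lambda_{path}}x_\lambda$ is the amount of flow passing from $s$ to $t$, and $C_1(x)=\sum_{(i,j)\in\mathcal{E}}b_{ij}x_{ij}$. $\Theta=\max_{x\in\mathcal{F}}F(x)$. $\Omega$ is the set of maximum flows of minimum transportation cost, i.e. minimizers of $C_1$ over $\{x\in\mathcal{F}: F(x)=\Theta\}$.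 An $s$-$t$ cut is a partition $\{S,T\}$ of $\mathcal{V}$ with $s\in S$, $t\in T$; its cut-set is $E(\{S,T\})=\{(i,j)\in\mathcal{E}: i\in S, j\notin S\}$, its capacity is $\sum_{(i,j)\in E(\{S,T\})}c_{ij}$; a min-cut is a cut-set of an $s$-$t$ cut of minimum capacity. Attacks. $\mathcal{A}=\{0,1\}^{\mathcal{E}}$; $\mu_{ij}=1$ means edge $(i,j)$ is disrupted. $C_2(\mu)=\sum_{(i,j)\in\mathcal{E}}c_{ij}\mu_{ij}$. The effective flow $x^\mu$ has $x^\mu_\lambda=x_\lambda$ if $\lambda$ contains no disrupted edge and $x^\mu_\lambda=0$ otherwise; $F(x-x^\mu)=F(x)-F(x^\mu)$ is the lost flow. Game $\Gamma$. Player 1 chooses $x\in\mathcal{F}$ and player 2 simultaneously chooses $\mu\in\mathcal{A}$. With $p_1,p_2>0$, payoffs are $u_1(x,\mu)=p_1F(x^\mu)-C_1(x)$ and $u_2(x,\mu)=p_2F(x-x^\mu)-C_2(\mu)$. Mixed strategies: $\Delta(\mathcal{F})=\{\sigma^1\in[0,1]^{\mathcal{F}}:\sum_{x}\sigma^1_x=1\}$ and $\Delta(\mathcal{A})=\{\sigma^2\in[0,1]^{\mathcal{A}}:\sum_\mu\sigma^2_\mu=1\}$. For $\sigma=(\sigma^1,\sigma^2)$, $\mathbb{E}_\sigma[\varphi(x,\mu)]=\sum_x\sigma^1_x\sum_\mu\sigma^2_\mu\varphi(x,\mu)$ and $U_k(\sigma^1,\sigma^2)=\mathbb{E}_\sigma[u_k(x,\mu)]$.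 $\operatorname{supp}$ is the set of actions with positive probability. $\mathcal{S}_\Gamma$ is the set of mixed Nash equilibria: pairs $({\sigma^1}^*,{\sigma^2}^* )$ with $U_1({\sigma^1}^*,{\sigma^2}^* )\ge U_1(\sigma^1,{\sigma^2}^* )$ for all $\sigma^1\in\Delta(\mathcal{F})$ and $U_2({\sigma^1}^*,{\sigma^2}^* )\ge U_2({\sigma^1}^*,\sigma^2)$ for all $\sigma^2\in\Delta(\mathcal{A})$. Assumption 1. Let $\alpha=\min_{\lambda\in\Lambda_{path}}\sum_{(i,j)\in\lambda}b_{ij}$. There exists $x^*\in\Omega$ such that for every $\lambda\in\Lambda_{path}$, $x^*_\lambda>0$ implies $\sum_{(i,j)\in\lambda}b_{ij}=\alpha$. *)

theory Defs
  imports
    "HOL-Probability.Probability_Mass_Function"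
    "Graph_Theory.Pair_Digraph"
begin

section \<open>Networks and flows\<close>

type_synonym 'v edge = "'v \<times> 'v"

text \<open>
  Paths and loops are identified with their sets of edges. A simple path is determined by its
  edge set, and passing to edge sets identifies the rotations of a cycle, which as edge lists
  would be counted as different loops.
\<close>

definition st_paths :: "'v pair_pre_digraph \<Rightarrow> 'v \<Rightarrow> 'v \<Rightarrow> 'v edge set set" where
  "st_paths G s t = {set p |p. pre_digraph.apath (with_proj G) s p t}"

definition loops :: "'v pair_pre_digraph \<Rightarrow> 'v edge set set" where
  "loops G = {set p |p. pre_digraph.cycle (with_proj G) p}"

definition routes :: "'v pair_pre_digraph \<Rightarrow> 'v \<Rightarrow> 'v \<Rightarrow> 'v edge set set" where
  "routes G s t = st_paths G s t \<union> loops G"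

locale network = pair_fin_digraph G
  for G :: "'v pair_pre_digraph" +
  fixes s t :: 'v
    and c b :: "'v edge \<Rightarrow> real"
  assumes source_in_verts: "s \<in> pverts G"
    and sink_in_verts: "t \<in> pverts G"
    and source_neq_sink: "s \<noteq> t"
    and st_paths_nonempty: "st_paths G s t \<noteq> {}"
    and capacity_pos: "e \<in> parcs G \<Longrightarrow> c e > 0"
    and unit_cost_pos: "e \<in> parcs G \<Longrightarrow> b e > 0"

type_synonym 'v flow = "'v edge set \<Rightarrow> real"

definition edge_flow ::
    "'v pair_pre_digraph \<Rightarrow> 'v \<Rightarrow> 'v \<Rightarrow> 'v flow \<Rightarrow> 'v edge \<Rightarrow> real" where
  "edge_flow G s t x e = (\<Sum>l\<in>{l \<in> routes G s t. e \<in> l}. x l)"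

text \<open>
  Vectors indexed by the routes are extensional functions, so that two flows are equal iff their
  components are.
\<close>

definition feasible_flows ::
    "'v pair_pre_digraph \<Rightarrow> 'v \<Rightarrow> 'v \<Rightarrow> ('v edge \<Rightarrow> real) \<Rightarrow> 'v flow set" where
  "feasible_flows G s t c =
     {x \<in> routes G s t \<rightarrow>\<^sub>E {0..}. \<forall>e\<in>parcs G. edge_flow G s t x e \<le> c e}"

definition flow_value :: "'v pair_pre_digraph \<Rightarrow> 'v \<Rightarrow> 'v \<Rightarrow> 'v flow \<Rightarrow> real" where
  "flow_value G s t x = (\<Sum>l\<in>st_paths G s t. x l)"

definition transport_cost ::
    "'v pair_pre_digraph \<Rightarrow> 'v \<Rightarrow> 'v \<Rightarrow> ('v edge \<Rightarrow> real) \<Rightarrow> 'v flow \<Rightarrow> real" where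
  "transport_cost G s t b x = (\<Sum>e\<in>parcs G. b e * edge_flow G s t x e)"

definition max_flow_value ::
    "'v pair_pre_digraph \<Rightarrow> 'v \<Rightarrow> 'v \<Rightarrow> ('v edge \<Rightarrow> real) \<Rightarrow> real" where
  "max_flow_value G s t c = (GREATEST r. r \<in> flow_value G s t ` feasible_flows G s t c)"

definition min_cost_max_flows ::
    "'v pair_pre_digraph \<Rightarrow> 'v \<Rightarrow> 'v \<Rightarrow> ('v edge \<Rightarrow> real) \<Rightarrow> ('v edge \<Rightarrow> real) \<Rightarrow> 'v flow set" where
  "min_cost_max_flows G s t c b =
     {x. is_arg_min (transport_cost G s t b)
           (\<lambda>x. x \<in> feasible_flows G s t c \<and> flow_value G s t x = max_flow_value G s t c) x}"

definition min_path_cost ::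
    "'v pair_pre_digraph \<Rightarrow> 'v \<Rightarrow> 'v \<Rightarrow> ('v edge \<Rightarrow> real) \<Rightarrow> real" where
  "min_path_cost G s t b = (MIN l\<in>st_paths G s t. \<Sum>e\<in>l. b e)"

definition cheapest_paths_assumption ::
    "'v pair_pre_digraph \<Rightarrow> 'v \<Rightarrow> 'v \<Rightarrow> ('v edge \<Rightarrow> real) \<Rightarrow> ('v edge \<Rightarrow> real) \<Rightarrow> bool" where
  "cheapest_paths_assumption G s t c b \<longleftrightarrow>
     (\<exists>x\<in>min_cost_max_flows G s t c b. \<forall>l\<in>st_paths G s t.
        x l > 0 \<longrightarrow> (\<Sum>e\<in>l. b e) = min_path_cost G s t b)"

section \<open>Cuts\<close>

definition st_cut ::
    "'v pair_pre_digraph \<Rightarrow> 'v \<Rightarrow> 'v \<Rightarrow> 'v set \<Rightarrow> 'v set \<Rightarrow> bool" where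
  "st_cut G s t S T \<longleftrightarrow> S \<union> T = pverts G \<and> S \<inter> T = {} \<and> s \<in> S \<and> t \<in> T"

definition cut_set :: "'v pair_pre_digraph \<Rightarrow> 'v set \<Rightarrow> 'v edge set" where
  "cut_set G S = {(i, j) \<in> parcs G. i \<in> S \<and> j \<notin> S}"

definition min_cuts ::
    "'v pair_pre_digraph \<Rightarrow> 'v \<Rightarrow> 'v \<Rightarrow> ('v edge \<Rightarrow> real) \<Rightarrow> 'v edge set set" where
  "min_cuts G s t c =
     {cut_set G S |S T. st_cut G s t S T \<and>
        (\<forall>S' T'. st_cut G s t S' T' \<longrightarrow> (\<Sum>e\<in>cut_set G S. c e) \<le> (\<Sum>e\<in>cut_set G S'. c e))}"

section \<open>Attacks and the game\<close>

type_synonym 'v attack = "'v edge \<Rightarrow> real"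

definition attacks :: "'v pair_pre_digraph \<Rightarrow> 'v attack set" where
  "attacks G = parcs G \<rightarrow>\<^sub>E {0, 1}"

definition attack_on :: "'v pair_pre_digraph \<Rightarrow> 'v edge set \<Rightarrow> 'v attack" where
  "attack_on G D = restrict (indicator D) (parcs G)"

definition attack_cost ::
    "'v pair_pre_digraph \<Rightarrow> ('v edge \<Rightarrow> real) \<Rightarrow> 'v attack \<Rightarrow> real" where
  "attack_cost G c \<mu> = (\<Sum>e\<in>parcs G. c e * \<mu> e)"

definition effective_flow ::
    "'v pair_pre_digraph \<Rightarrow> 'v \<Rightarrow> 'v \<Rightarrow> 'v flow \<Rightarrow> 'v attack \<Rightarrow> 'v flow" where
  "effective_flow G s t x \<mu> = (\<lambda>l\<in>routes G s t. if \<exists>e\<in>l. \<mu> e = 1 then 0 else x l)"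

definition payoff1 ::
    "'v pair_pre_digraph \<Rightarrow> 'v \<Rightarrow> 'v \<Rightarrow> ('v edge \<Rightarrow> real) \<Rightarrow> real \<Rightarrow> 'v flow \<Rightarrow> 'v attack \<Rightarrow> real" where
  "payoff1 G s t b p1 x \<mu> =
     p1 * flow_value G s t (effective_flow G s t x \<mu>) - transport_cost G s t b x"

definition payoff2 ::
    "'v pair_pre_digraph \<Rightarrow> 'v \<Rightarrow> 'v \<Rightarrow> ('v edge \<Rightarrow> real) \<Rightarrow> real \<Rightarrow> 'v flow \<Rightarrow> 'v attack \<Rightarrow> real" where
  "payoff2 G s t c p2 x \<mu> =
     p2 * flow_value G s t (\<lambda>l. x l - effective_flow G s t x \<mu> l) - attack_cost G c \<mu>"

text \<open>
  A family of numbers in \<open>[0,1]\<close> with (unordered) sum 1 has countable support, so mixed strategies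
  on a possibly uncountable set of actions are exactly the probability mass functions supported in
  it, and their support is \<^const>\<open>set_pmf\<close>. Both payoffs are bounded on the feasible actions,
  so the expectations below are the absolutely convergent sums weighted by the probabilities.
\<close>

definition mixed_strategies :: "'a set \<Rightarrow> 'a pmf set" where
  "mixed_strategies A = {\<sigma>. set_pmf \<sigma> \<subseteq> A}"

definition expected :: "('a \<Rightarrow> 'b \<Rightarrow> real) \<Rightarrow> 'a pmf \<Rightarrow> 'b pmf \<Rightarrow> real" where
  "expected \<phi> \<sigma>1 \<sigma>2 =
     measure_pmf.expectation \<sigma>1 (\<lambda>x. measure_pmf.expectation \<sigma>2 (\<lambda>\<mu>. \<phi> x \<mu>))"

definition mixed_nash_equilibria ::
    "'a set \<Rightarrow> 'b set \<Rightarrow> ('a \<Rightarrow> 'b \<Rightarrow> real) \<Rightarrow> ('a \<Rightarrow> 'b \<Rightarrow> real) \<Rightarrow> ('a pmf \<times> 'b pmf) set" where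
  "mixed_nash_equilibria A B u1 u2 =
     {(\<sigma>1, \<sigma>2) \<in> mixed_strategies A \<times> mixed_strategies B.
        (\<forall>\<sigma>1'\<in>mixed_strategies A. expected u1 \<sigma>1' \<sigma>2 \<le> expected u1 \<sigma>1 \<sigma>2) \<and>
        (\<forall>\<sigma>2'\<in>mixed_strategies B. expected u2 \<sigma>1 \<sigma>2' \<le> expected u2 \<sigma>1 \<sigma>2)}"

definition routing_game_equilibria ::
    "'v pair_pre_digraph \<Rightarrow> 'v \<Rightarrow> 'v \<Rightarrow> ('v edge \<Rightarrow> real) \<Rightarrow> ('v edge \<Rightarrow> real) \<Rightarrow> real \<Rightarrow> real
      \<Rightarrow> ('v flow pmf \<times> 'v attack pmf) set" where
  "routing_game_equilibria G s t c b p1 p2 =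
     mixed_nash_equilibria (feasible_flows G s t c) (attacks G)
       (payoff1 G s t b p1) (payoff2 G s t c p2)"

end

theory Submission imports Defs begin

text \<open>
  Dividing the payoffs by \<open>p1\<close> and \<open>p2\<close> shows that the game is strategically equivalent to a
  zero-sum game. It has an equilibrium in which player 1 sends no flow or a given
  \<open>x \<in> \<Omega>\<close>, the latter with probability \<open>1/p2\<close>, and player 2 attacks nothing or a minimum
  cut, the latter with probability \<open>1 - \<alpha>/p1\<close>. By interchangeability of equilibria every attack
  \<open>\<mu>\<close> in the support of an equilibrium is a best response to this strategy of player 1, so the
  flow of \<open>x\<close> lost under \<open>\<mu>\<close> equals the cost of \<open>\<mu>\<close>. The loss is at most \<open>\<Theta>\<close>
  and at most the total edge flow of \<open>x\<close> on the attacked edges, which is at most their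
  capacity, so these edges are saturated.

  That the minimum cut is a best response needs the max-flow min-cut theorem. As flows are given
  by routes, a maximum edge flow (which exists by compactness) is decomposed into paths.
\<close>

section \<open>Edge flows\<close>

definition net_outflow :: "'v pair_pre_digraph \<Rightarrow> ('v edge \<Rightarrow> real) \<Rightarrow> 'v \<Rightarrow> real" where
  "net_outflow G f v = (\<Sum>e\<in>parcs G. f e * (of_bool (fst e = v) - of_bool (snd e = v)))"

text \<open>Signs and capacities are left out deliberately, so that residual directions with
  negative entries also qualify and the property is stable under linear combinations. The quantifier
  over all \<open>v\<close> is harmless, since outside the vertices the net outflow is 0.\<close>

definition edge_flow_of_value ::
    "'v pair_pre_digraph \<Rightarrow> 'v \<Rightarrow> 'v \<Rightarrow> ('v edge \<Rightarrow> real) \<Rightarrow> real \<Rightarrow> bool" where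
  "edge_flow_of_value G s t f r \<longleftrightarrow>
     (\<forall>v. net_outflow G f v = r * (of_bool (v = s) - of_bool (v = t)))"

lemma net_outflow_add:
  "net_outflow G (\<lambda>e. f e + g e) v = net_outflow G f v + net_outflow G g v"
  by (simp add: net_outflow_def sum.distrib distrib_right)

lemma net_outflow_scale: "net_outflow G (\<lambda>e. k * f e) v = k * net_outflow G f v"
  by (simp add: net_outflow_def sum_distrib_left mult.assoc)

text \<open>Used with negative \<open>k\<close> to remove a path from a flow and with small positive
  \<open>k\<close> to augment a flow along a residual direction.\<close>

lemma edge_flow_of_value_add_scaled:
  assumes "edge_flow_of_value G s t f r" "edge_flow_of_value G s t g q"
  shows "edge_flow_of_value G s t (\<lambda>e. f e + k * g e) (r + k * q)"
  using assms by (simp only: edge_flow_of_value_def net_outflow_add net_outflow_scale distrib_right mult.assoc)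
    simp

lemma (in pair_fin_digraph) net_outflow_unit:
  assumes "a \<in> parcs G"
  shows "net_outflow G (\<lambda>e. of_bool (e = a)) v = of_bool (fst a = v) - of_bool (snd a = v)"
proof -
  have "net_outflow G (\<lambda>e. of_bool (e = a)) v =
      (\<Sum>e\<in>parcs G. if e = a then of_bool (fst a = v) - of_bool (snd a = v) else 0)"
    unfolding net_outflow_def by (rule sum.cong) auto
  then show ?thesis using assms pair_finite_arcs by simp
qed

text \<open>The unit flows on the successive arcs telescope. Simplicity of the path makes its arcs
  distinct, so the indicator of the arc set is the sum of these unit flows.\<close>

lemma (in pair_fin_digraph) net_outflow_apath:
  assumes "apath u p w"
  shows "net_outflow G (\<lambda>e. of_bool (e \<in> set p)) v = of_bool (v = u) - of_bool (v = w)"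
  using assms
proof (induction p arbitrary: u)
  case Nil
  then show ?case by (auto simp: apath_Nil_iff net_outflow_def)
next
  case (Cons a p)
  have a: "a \<in> parcs G" "u = fst a" "apath (snd a) p w"
    using Cons.prems by (auto simp: apath_Cons_iff)
  have "distinct (a # p)"
    using Cons.prems by (meson apath_def distinct_verts_imp_distinct)
  then have "(\<lambda>e. of_bool (e \<in> set (a # p))) = (\<lambda>e. of_bool (e = a) + of_bool (e \<in> set p) :: real)"
    by (auto simp: fun_eq_iff)
  then have "net_outflow G (\<lambda>e. of_bool (e \<in> set (a # p))) v =
      net_outflow G (\<lambda>e. of_bool (e = a)) v + net_outflow G (\<lambda>e. of_bool (e \<in> set p)) v"
    by (simp only: net_outflow_add)
  also have "\<dots> = of_bool (fst a = v) - of_bool (snd a = v) + (of_bool (v = snd a) - of_bool (v = w))"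
    using a Cons.IH[OF a(3)] net_outflow_unit[OF a(1)] by simp
  finally show ?case using a by auto
qed

text \<open>Summing the net outflows over \<open>R\<close> leaves only the contribution
  \<open>r\<close> of \<open>s\<close>. Read arc by arc, the same sum cancels on arcs with both ends
  in \<open>R\<close>.\<close>

lemma (in pair_fin_digraph) edge_flow_value_across_cut:
  assumes "edge_flow_of_value G s t f r" "s \<in> R" "t \<notin> R" "R \<subseteq> pverts G"
  shows "r = (\<Sum>e\<in>parcs G. f e * (of_bool (fst e \<in> R) - of_bool (snd e \<in> R)))"
proof -
  have fin: "finite R" using assms(4) pair_finite_verts finite_subset by blast
  have ind: "(\<Sum>v\<in>R. of_bool (u = v)) = (of_bool (u \<in> R) :: real)" for u
    using fin by (simp add: of_bool_def)
  have "(\<Sum>v\<in>R. net_outflow G f v) = (\<Sum>v\<in>R. if v = s then r else 0)"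
    using assms by (intro sum.cong) (auto simp: edge_flow_of_value_def)
  also have "\<dots> = r" using fin assms(2) by simp
  finally have "r = (\<Sum>v\<in>R. net_outflow G f v)" ..
  also have "\<dots> = (\<Sum>e\<in>parcs G. \<Sum>v\<in>R. f e * (of_bool (fst e = v) - of_bool (snd e = v)))"
    unfolding net_outflow_def by (rule sum.swap)
  also have "\<dots> = (\<Sum>e\<in>parcs G. f e * (of_bool (fst e \<in> R) - of_bool (snd e \<in> R)))"
    by (simp add: sum_distrib_left[symmetric] sum_subtractf ind)
  finally show ?thesis .
qed

section \<open>Decomposition of an edge flow into paths\<close>

lemma (in pair_fin_digraph) routes_subset_parcs: "l \<in> routes G s t \<Longrightarrow> l \<subseteq> parcs G"
  by (auto simp: routes_def st_paths_def loops_def apath_def cycle_def awalk_def)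

lemma (in pair_fin_digraph) finite_routes: "finite (routes G s t)"
  by (rule finite_subset[of _ "Pow (parcs G)"]) (use routes_subset_parcs pair_finite_arcs in auto)

lemma (in pair_fin_digraph) finite_st_paths: "finite (st_paths G s t)"
  using finite_routes by (rule finite_subset[rotated]) (auto simp: routes_def)

lemma (in pair_fin_digraph) st_path_subset_parcs: "l \<in> st_paths G s t \<Longrightarrow> l \<subseteq> parcs G"
  using routes_subset_parcs[of l s t] by (simp add: routes_def)

text \<open>Let \<open>R\<close> collect the vertices reachable from \<open>s\<close> along arcs
  with positive flow. If \<open>t\<close> were outside \<open>R\<close>, no flow would leave
  \<open>R\<close>, and the value crossing this cut would be at most 0.\<close>

lemma (in pair_fin_digraph) st_path_in_support:
  assumes nonneg: "\<And>e. e \<in> parcs G \<Longrightarrow> 0 \<le> f e"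
    and flow: "edge_flow_of_value G s t f r" and "0 < r" and "s \<in> pverts G"
  obtains l where "l \<in> st_paths G s t" "\<And>e. e \<in> l \<Longrightarrow> 0 < f e"
proof -
  define H where "H = \<lparr>pverts = pverts G, parcs = {e \<in> parcs G. 0 < f e}\<rparr>"
  interpret H: pair_fin_digraph H
    using pair_finite_verts pair_finite_arcs arc_fst_in_verts arc_snd_in_verts
    by unfold_locales (auto simp: H_def)
  define R where "R = {v. s \<rightarrow>\<^sup>*\<^bsub>with_proj H\<^esub> v}"
  have "s \<in> R"
    using \<open>s \<in> pverts G\<close> H.reachable_refl by (simp add: R_def H_def)
  have "R \<subseteq> pverts G"
    using H.reachable_in_verts(2) by (auto simp: R_def H_def)
  have closed: "snd e \<in> R" if "e \<in> parcs G" "0 < f e" "fst e \<in> R" for e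
  proof -
    have "fst e \<rightarrow>\<^bsub>with_proj H\<^esub> snd e" using that by (simp add: H_def)
    then show ?thesis using that(3) H.reachable_adj_trans by (auto simp: R_def)
  qed
  have "t \<in> R"
  proof (rule ccontr)
    assume "t \<notin> R"
    have "r = (\<Sum>e\<in>parcs G. f e * (of_bool (fst e \<in> R) - of_bool (snd e \<in> R)))"
      by (rule edge_flow_value_across_cut) fact+
    also have "\<dots> \<le> 0"
    proof (rule sum_nonpos)
      fix e assume e: "e \<in> parcs G"
      show "f e * (of_bool (fst e \<in> R) - of_bool (snd e \<in> R)) \<le> 0"
        using nonneg[OF e] closed[OF e] by (cases "f e = 0") (auto simp: mult_le_0_iff)
    qed
    finally show False using \<open>0 < r\<close> by simp
  qed
  then obtain p where p: "H.apath s p t"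
    using H.reachable_apath by (auto simp: R_def)
  then have sub: "set p \<subseteq> {e \<in> parcs G. 0 < f e}"
    unfolding H.apath_def H.awalk_def by (auto simp: H_def)
  have "apath s p t"
    using p sub unfolding H.apath_def H.awalk_def apath_def awalk_def by (auto simp: H_def)
  then have "set p \<in> st_paths G s t" by (auto simp: st_paths_def)
  then show ?thesis using that sub by blast
qed

text \<open>Paths in the support are peeled off one at a time. Each step either exhausts the value
  or empties an arc, which drives the induction on the number of arcs with nonzero flow. The bound
  by \<open>f\<close> is only an inequality because circulations left over at the end are
  discarded.\<close>

lemma (in pair_fin_digraph) edge_flow_path_decomposition:
  assumes "\<And>e. e \<in> parcs G \<Longrightarrow> 0 \<le> f e"
    and "edge_flow_of_value G s t f r" and "0 \<le> r" and s: "s \<in> pverts G" and st: "s \<noteq> t"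
  shows "\<exists>x. (\<forall>l. 0 \<le> x l) \<and> (\<Sum>l\<in>st_paths G s t. x l) = r \<and>
     (\<forall>e\<in>parcs G. (\<Sum>l\<in>{l \<in> st_paths G s t. e \<in> l}. x l) \<le> f e)"
  using assms(1-3)
proof (induction "card {e \<in> parcs G. f e \<noteq> 0}" arbitrary: f r rule: less_induct)
  case less
  note fin = finite_st_paths[of s t]
  show ?case
  proof (cases "r = 0")
    case True
    then show ?thesis using less.prems by (intro exI[of _ "\<lambda>_. 0"]) auto
  next
    case False
    then have "0 < r" using less.prems by simp
    obtain l where l: "l \<in> st_paths G s t" and pos: "\<And>e. e \<in> l \<Longrightarrow> 0 < f e"
      using st_path_in_support[OF less.prems(1,2) \<open>0 < r\<close> s] by blast
    have sub: "l \<subseteq> parcs G" using l by (rule st_path_subset_parcs)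
    have finl: "finite l" using sub pair_finite_arcs finite_subset by blast
    have path: "edge_flow_of_value G s t (\<lambda>e. of_bool (e \<in> l)) 1"
      using l net_outflow_apath by (auto simp: st_paths_def edge_flow_of_value_def)
    have "l \<noteq> {}"
    proof
      assume "l = {}"
      with path have "net_outflow G (\<lambda>e. 0) s = 1"
        using st by (simp add: edge_flow_of_value_def)
      then show False by (simp add: net_outflow_def)
    qed
    \<comment> \<open>The bottleneck of the path, capped by \<open>r\<close>: circulations sharing
      arcs with the path can make the bottleneck larger than the value still to be routed.\<close>
    define d where "d = min r (Min (f ` l))"
    have "0 < d" using \<open>0 < r\<close> pos finl \<open>l \<noteq> {}\<close> by (simp add: d_def)
    have d_le: "d \<le> f e" if "e \<in> l" for e
      using that finl by (simp add: d_def min.coboundedI2)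
    define g where "g = (\<lambda>e. f e + (- d) * of_bool (e \<in> l))"
    have g: "edge_flow_of_value G s t g (r - d)"
      using edge_flow_of_value_add_scaled[OF less.prems(2) path, of "- d"] by (simp add: g_def)
    have g_nonneg: "0 \<le> g e" if "e \<in> parcs G" for e
      using less.prems(1)[OF that] d_le by (auto simp: g_def)
    have "\<exists>x. (\<forall>l. 0 \<le> x l) \<and> (\<Sum>l\<in>st_paths G s t. x l) = r - d \<and>
       (\<forall>e\<in>parcs G. (\<Sum>l\<in>{l \<in> st_paths G s t. e \<in> l}. x l) \<le> g e)"
    proof (cases "d = r")
      case True
      then show ?thesis using g_nonneg by (intro exI[of _ "\<lambda>_. 0"]) auto
    next
      case False
      then have "d = Min (f ` l)" by (simp add: d_def min_def split: if_splits)
      moreover have "Min (f ` l) \<in> f ` l" using finl \<open>l \<noteq> {}\<close> by (intro Min_in) simp_all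
      \<comment> \<open>A bottleneck arc: it carries flow in \<open>f\<close> but none in
        \<open>g\<close>, so the support shrinks strictly.\<close>
      ultimately obtain a where a: "a \<in> l" "d = f a" by (metis imageE)
      have "{e \<in> parcs G. g e \<noteq> 0} \<subset> {e \<in> parcs G. f e \<noteq> 0}"
      proof
        show "{e \<in> parcs G. g e \<noteq> 0} \<subseteq> {e \<in> parcs G. f e \<noteq> 0}"
          using pos by (fastforce simp: g_def)
        show "{e \<in> parcs G. g e \<noteq> 0} \<noteq> {e \<in> parcs G. f e \<noteq> 0}"
          using a pos[OF a(1)] sub by (auto simp: g_def)
      qed
      then have "card {e \<in> parcs G. g e \<noteq> 0} < card {e \<in> parcs G. f e \<noteq> 0}"
        using pair_finite_arcs by (intro psubset_card_mono) auto
      moreover have "0 \<le> r - d" by (simp add: d_def)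
      ultimately show ?thesis using less.hyps g g_nonneg by blast
    qed
    then obtain x where x: "\<And>k. 0 \<le> x k" "(\<Sum>k\<in>st_paths G s t. x k) = r - d"
      "\<And>e. e \<in> parcs G \<Longrightarrow> (\<Sum>k\<in>{k \<in> st_paths G s t. e \<in> k}. x k) \<le> g e"
      by blast
    define y where "y = (\<lambda>k. x k + (if k = l then d else 0))"
    show ?thesis
    proof (intro exI[of _ y] conjI allI ballI)
      show "0 \<le> y k" for k using x(1)[of k] \<open>0 < d\<close> by (simp add: y_def)
      show "(\<Sum>k\<in>st_paths G s t. y k) = r"
        using x(2) l fin by (simp add: y_def sum.distrib)
      show "(\<Sum>k\<in>{k \<in> st_paths G s t. e \<in> k}. y k) \<le> f e" if "e \<in> parcs G" for e
        using x(3)[OF that] l fin by (cases "e \<in> l") (simp_all add: y_def sum.distrib g_def)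
    qed
  qed
qed

section \<open>Residual graph and the max-flow min-cut theorem for edge flows\<close>

definition residual_arcs ::
    "'v pair_pre_digraph \<Rightarrow> ('v edge \<Rightarrow> real) \<Rightarrow> ('v edge \<Rightarrow> real) \<Rightarrow> 'v rel" where
  "residual_arcs G c f =
     {(u, v). ((u, v) \<in> parcs G \<and> f (u, v) < c (u, v)) \<or> ((v, u) \<in> parcs G \<and> 0 < f (v, u))}"

text \<open>One unit is pushed along a residual walk, adding 1 on forward arcs and subtracting 1 on
  backward ones. The walk may repeat arcs; cancellation does no damage, since the invariant concerns
  only the signs of \<open>g\<close>.\<close>

lemma (in pair_fin_digraph) residual_direction:
  assumes "(s, v) \<in> (residual_arcs G c f)\<^sup>*"
  shows "\<exists>g. edge_flow_of_value G s v g 1 \<and>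
    (\<forall>e\<in>parcs G. (0 < g e \<longrightarrow> f e < c e) \<and> (g e < 0 \<longrightarrow> 0 < f e))"
  using assms
proof (induction rule: rtrancl_induct)
  case base
  show ?case
    by (intro exI[of _ "\<lambda>_. 0"]) (auto simp: edge_flow_of_value_def net_outflow_def)
next
  case (step v w)
  then obtain g where g: "edge_flow_of_value G s v g 1"
    "\<And>e. e \<in> parcs G \<Longrightarrow> (0 < g e \<longrightarrow> f e < c e) \<and> (g e < 0 \<longrightarrow> 0 < f e)" by blast
  consider "(v, w) \<in> parcs G" "f (v, w) < c (v, w)" | "(w, v) \<in> parcs G" "0 < f (w, v)"
    using step.hyps(2) by (auto simp: residual_arcs_def)
  then show ?case
  proof cases
    case 1
    define h where "h = (\<lambda>e. g e + 1 * of_bool (e = (v, w)))"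
    have "edge_flow_of_value G s w h 1"
      using g(1) net_outflow_unit[OF 1(1)]
      by (auto simp: edge_flow_of_value_def h_def net_outflow_add)
    moreover have "(0 < h e \<longrightarrow> f e < c e) \<and> (h e < 0 \<longrightarrow> 0 < f e)" if "e \<in> parcs G" for e
      using g(2)[OF that] 1(2) by (auto simp: h_def)
    ultimately show ?thesis by blast
  next
    case 2
    define h where "h = (\<lambda>e. g e + (- 1) * of_bool (e = (w, v)))"
    have "edge_flow_of_value G s w h 1"
      using g(1) net_outflow_unit[OF 2(1)]
      unfolding edge_flow_of_value_def h_def net_outflow_add net_outflow_scale by auto
    moreover have "(0 < h e \<longrightarrow> f e < c e) \<and> (h e < 0 \<longrightarrow> 0 < f e)" if "e \<in> parcs G" for e
      using g(2)[OF that] 2(2) by (auto simp: h_def)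
    ultimately show ?thesis by blast
  qed
qed

text \<open>On each edge the bounds hold for all sufficiently small positive steps: a bound towards
  which \<open>g\<close> points is slack and survives by continuity, the other one is only moved
  away from. Finiteness of \<open>E\<close> gives a common step.\<close>

lemma small_step_feasible:
  fixes f g c :: "'a \<Rightarrow> real"
  assumes "finite E" "\<And>e. e \<in> E \<Longrightarrow> 0 \<le> f e \<and> f e \<le> c e"
    and dir: "\<And>e. e \<in> E \<Longrightarrow> (0 < g e \<longrightarrow> f e < c e) \<and> (g e < 0 \<longrightarrow> 0 < f e)"
  obtains \<epsilon> where "0 < \<epsilon>" "\<And>e. e \<in> E \<Longrightarrow> 0 \<le> f e + \<epsilon> * g e \<and> f e + \<epsilon> * g e \<le> c e"
proof -
  have "\<forall>\<^sub>F \<epsilon> in at_right 0. 0 \<le> f e + \<epsilon> * g e \<and> f e + \<epsilon> * g e \<le> c e" if e: "e \<in> E" for e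
  proof -
    have lim: "((\<lambda>\<epsilon>. f e + \<epsilon> * g e) \<longlongrightarrow> f e) (at_right 0)"
      by (auto intro!: tendsto_eq_intros)
    have pos: "\<forall>\<^sub>F \<epsilon> in at_right 0. (0::real) < \<epsilon>"
      by (simp add: eventually_at_right_less)
    consider "g e = 0" | "0 < g e" | "g e < 0" by linarith
    then show ?thesis
    proof cases
      case 1
      then show ?thesis using assms(2)[OF e] by simp
    next
      case 2
      then have "\<forall>\<^sub>F \<epsilon> in at_right 0. f e + \<epsilon> * g e < c e"
        using dir[OF e] lim by (intro order_tendstoD(2)[OF lim]) auto
      then show ?thesis using pos
        by eventually_elim (use 2 assms(2)[OF e] in auto)
    next
      case 3
      then have "\<forall>\<^sub>F \<epsilon> in at_right 0. 0 < f e + \<epsilon> * g e"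
        using dir[OF e] by (intro order_tendstoD(1)[OF lim]) auto
      then show ?thesis using pos
      proof eventually_elim
        case (elim \<epsilon>)
        then have "\<epsilon> * g e \<le> 0" using 3 by (simp add: mult_le_0_iff)
        then show ?case using elim assms(2)[OF e] by linarith
      qed
    qed
  qed
  then have "\<forall>\<^sub>F \<epsilon> in at_right 0. \<forall>e\<in>E. 0 \<le> f e + \<epsilon> * g e \<and> f e + \<epsilon> * g e \<le> c e"
    using \<open>finite E\<close> by (simp add: eventually_ball_finite)
  moreover have "\<forall>\<^sub>F \<epsilon> in at_right 0. (0::real) < \<epsilon>"
    by (simp add: eventually_at_right_less)
  ultimately have "\<forall>\<^sub>F \<epsilon> in at_right 0. 0 < \<epsilon> \<and> (\<forall>e\<in>E. 0 \<le> f e + \<epsilon> * g e \<and> f e + \<epsilon> * g e \<le> c e)"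
    by eventually_elim auto
  then have "\<exists>\<epsilon>. 0 < \<epsilon> \<and> (\<forall>e\<in>E. 0 \<le> f e + \<epsilon> * g e \<and> f e + \<epsilon> * g e \<le> c e)"
    by (rule eventually_happens'[rotated]) simp
  then show ?thesis using that by blast
qed

text \<open>The value is a continuous function on a nonempty compact set of flows and hence attains
  its maximum there.\<close>

lemma (in pair_fin_digraph) max_edge_flow_exists:
  assumes c: "\<And>e. e \<in> parcs G \<Longrightarrow> 0 \<le> c e" and st: "s \<noteq> t"
  obtains f r where "\<And>e. e \<in> parcs G \<Longrightarrow> 0 \<le> f e \<and> f e \<le> c e" "edge_flow_of_value G s t f r" "0 \<le> r"
    "\<And>g q. \<lbrakk>\<And>e. e \<in> parcs G \<Longrightarrow> 0 \<le> g e \<and> g e \<le> c e; edge_flow_of_value G s t g q\<rbrakk> \<Longrightarrow> q \<le> r"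
proof -
  \<comment> \<open>Pinning the flow to 0 off the arcs makes the box compact in the product topology
    on the full function space.\<close>
  define B where "B = (\<lambda>e. if e \<in> parcs G then {0..c e} else {0::real})"
  \<comment> \<open>Conservation with the value expressed through \<open>f\<close> itself, which
    turns it into a family of closed equations in \<open>f\<close>.\<close>
  define Q where "Q = {f. edge_flow_of_value G s t f (net_outflow G f s)}"
  have cont: "continuous_on UNIV (\<lambda>f. net_outflow G f v)" for v
    unfolding net_outflow_def by (intro continuous_intros continuous_on_product_coordinates)
  have "compactin (product_topology (\<lambda>e. euclidean) UNIV) (PiE UNIV B)"
    by (simp add: compactin_PiE B_def)
  then have "compact (PiE UNIV B)"
    by (simp only: euclidean_product_topology compactin_euclidean_iff)
  moreover have "closed Q"
    unfolding Q_def edge_flow_of_value_def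
    by (intro closed_Collect_all closed_Collect_eq continuous_intros cont)
  ultimately have comp: "compact (PiE UNIV B \<inter> Q)" by (rule compact_Int_closed)
  have zero: "(\<lambda>_. 0) \<in> PiE UNIV B \<inter> Q"
    using c by (auto simp: B_def Q_def edge_flow_of_value_def net_outflow_def)
  then have nonempty: "PiE UNIV B \<inter> Q \<noteq> {}" by blast
  obtain f where f: "f \<in> PiE UNIV B \<inter> Q"
    and max: "\<And>g. g \<in> PiE UNIV B \<inter> Q \<Longrightarrow> net_outflow G g s \<le> net_outflow G f s"
    using continuous_attains_sup[OF comp nonempty continuous_on_subset[OF cont[of s] subset_UNIV]]
    by metis
  show ?thesis
  proof
    show "0 \<le> f e \<and> f e \<le> c e" if "e \<in> parcs G" for e
      using f that PiE_mem[of f UNIV B e] by (simp add: B_def)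
    show "edge_flow_of_value G s t f (net_outflow G f s)" using f by (simp add: Q_def)
    show "0 \<le> net_outflow G f s" using max[OF zero] by (simp add: net_outflow_def)
  next
    fix g q
    assume g: "\<And>e. e \<in> parcs G \<Longrightarrow> 0 \<le> g e \<and> g e \<le> c e" "edge_flow_of_value G s t g q"
    \<comment> \<open>A competitor is arbitrary off the arcs; truncating it puts it into the box
      without changing its net outflow.\<close>
    let ?g = "\<lambda>e. if e \<in> parcs G then g e else 0"
    have eq: "net_outflow G ?g = net_outflow G g"
      by (auto simp: net_outflow_def fun_eq_iff intro!: sum.cong)
    have q: "q = net_outflow G g s" using g(2) st by (simp add: edge_flow_of_value_def)
    have "?g \<in> PiE UNIV B \<inter> Q"
    proof
      show "?g \<in> PiE UNIV B" using g(1) by (auto simp: B_def)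
      have "edge_flow_of_value G s t ?g q"
        using g(2) unfolding edge_flow_of_value_def eq .
      then show "?g \<in> Q" unfolding Q_def mem_Collect_eq eq q .
    qed
    from max[OF this] show "q \<le> net_outflow G f s" unfolding eq q .
  qed
qed

text \<open>\<open>R\<close> is the residually reachable part for a maximum flow. It misses
  \<open>t\<close>, as otherwise a small step along a residual direction would raise the value.
  Hence arcs leaving \<open>R\<close> are full and arcs entering it are empty, so the value equals
  the capacity of the cut.\<close>

lemma (in pair_fin_digraph) max_edge_flow_min_cut:
  assumes c: "\<And>e. e \<in> parcs G \<Longrightarrow> 0 \<le> c e" and s: "s \<in> pverts G" and t: "t \<in> pverts G"
    and st: "s \<noteq> t"
  obtains f R where "\<And>e. e \<in> parcs G \<Longrightarrow> 0 \<le> f e \<and> f e \<le> c e"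
    "edge_flow_of_value G s t f (\<Sum>e\<in>cut_set G R. c e)" "st_cut G s t R (pverts G - R)"
proof -
  obtain f r where f: "\<And>e. e \<in> parcs G \<Longrightarrow> 0 \<le> f e \<and> f e \<le> c e" "edge_flow_of_value G s t f r"
    and max: "\<And>g q. \<lbrakk>\<And>e. e \<in> parcs G \<Longrightarrow> 0 \<le> g e \<and> g e \<le> c e; edge_flow_of_value G s t g q\<rbrakk>
      \<Longrightarrow> q \<le> r"
    using max_edge_flow_exists[of c s t] c st by metis
  define R where "R = {v \<in> pverts G. (s, v) \<in> (residual_arcs G c f)\<^sup>*}"
  have "t \<notin> R"
  proof
    assume "t \<in> R"
    then obtain g where g: "edge_flow_of_value G s t g 1"
      "\<And>e. e \<in> parcs G \<Longrightarrow> (0 < g e \<longrightarrow> f e < c e) \<and> (g e < 0 \<longrightarrow> 0 < f e)"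
      using residual_direction by (fastforce simp: R_def)
    obtain \<epsilon> where "0 < \<epsilon>"
      "\<And>e. e \<in> parcs G \<Longrightarrow> 0 \<le> f e + \<epsilon> * g e \<and> f e + \<epsilon> * g e \<le> c e"
      using small_step_feasible[of "parcs G" f c g] pair_finite_arcs f(1) g(2) by metis
    then show False
      using max[of "\<lambda>e. f e + \<epsilon> * g e" "r + \<epsilon> * 1"] edge_flow_of_value_add_scaled[OF f(2) g(1), of \<epsilon>]
      by simp
  qed
  have "s \<in> R" using s by (simp add: R_def)
  have full: "f e = c e" if "e \<in> parcs G" "fst e \<in> R" "snd e \<notin> R" for e
  proof (rule ccontr)
    assume "f e \<noteq> c e"
    then have "(fst e, snd e) \<in> residual_arcs G c f"
      using f(1)[OF that(1)] that(1) by (auto simp: residual_arcs_def)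
    then have "snd e \<in> R"
      using that arc_snd_in_verts by (auto simp: R_def intro: rtrancl_into_rtrancl)
    then show False using that by simp
  qed
  have empty: "f e = 0" if "e \<in> parcs G" "fst e \<notin> R" "snd e \<in> R" for e
  proof (rule ccontr)
    assume "f e \<noteq> 0"
    then have "(snd e, fst e) \<in> residual_arcs G c f"
      using f(1)[OF that(1)] that(1) by (auto simp: residual_arcs_def)
    then have "fst e \<in> R"
      using that arc_fst_in_verts by (auto simp: R_def intro: rtrancl_into_rtrancl)
    then show False using that by simp
  qed
  have "r = (\<Sum>e\<in>parcs G. f e * (of_bool (fst e \<in> R) - of_bool (snd e \<in> R)))"
    using f(2) \<open>s \<in> R\<close> \<open>t \<notin> R\<close> by (intro edge_flow_value_across_cut) (auto simp: R_def)
  also have "\<dots> = (\<Sum>e\<in>parcs G. if e \<in> cut_set G R then c e else 0)"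
    using full empty by (intro sum.cong) (auto simp: cut_set_def)
  also have "\<dots> = (\<Sum>e\<in>cut_set G R. c e)"
    using pair_finite_arcs by (simp add: sum.inter_restrict[symmetric]) (auto simp: cut_set_def intro!: sum.cong)
  finally have "edge_flow_of_value G s t f (\<Sum>e\<in>cut_set G R. c e)" using f(2) by simp
  moreover have "st_cut G s t R (pverts G - R)"
    using \<open>s \<in> R\<close> \<open>t \<notin> R\<close> t by (auto simp: st_cut_def R_def)
  ultimately show ?thesis using that f(1) by blast
qed


section \<open>Maximum flows, minimum cuts and transportation costs\<close>

context network
begin

text \<open>Apart from the cost of the attack, both payoffs depend on the attack only through this
  quantity, as \<open>payoff1_eq\<close> and \<open>payoff2_eq\<close> show.\<close>

definition lost_flow :: "'v flow \<Rightarrow> 'v attack \<Rightarrow> real" where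
  "lost_flow x \<mu> = (\<Sum>l\<in>{l \<in> st_paths G s t. \<exists>e\<in>l. \<mu> e = 1}. x l)"

lemma feasible_flow_nonneg: "\<lbrakk>x \<in> feasible_flows G s t c; l \<in> routes G s t\<rbrakk> \<Longrightarrow> 0 \<le> x l"
  by (auto simp: feasible_flows_def PiE_iff)

lemma edge_flow_nonneg: "x \<in> feasible_flows G s t c \<Longrightarrow> 0 \<le> edge_flow G s t x e"
  unfolding edge_flow_def by (rule sum_nonneg) (auto intro: feasible_flow_nonneg)

lemma edge_flow_le: "\<lbrakk>x \<in> feasible_flows G s t c; e \<in> parcs G\<rbrakk> \<Longrightarrow> edge_flow G s t x e \<le> c e"
  by (auto simp: feasible_flows_def)

text \<open>A path meeting \<open>D\<close> counts once on the left and once per common edge on the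
  right, where all other routes add nonnegative amounts.\<close>

lemma flow_through_edges_le:
  assumes x: "x \<in> feasible_flows G s t c" and D: "D \<subseteq> parcs G"
  shows "(\<Sum>l\<in>{l \<in> st_paths G s t. l \<inter> D \<noteq> {}}. x l) \<le> (\<Sum>e\<in>D. edge_flow G s t x e)"
proof -
  have finD: "finite D" using D pair_finite_arcs finite_subset by blast
  have "(\<Sum>l\<in>{l \<in> st_paths G s t. l \<inter> D \<noteq> {}}. x l) \<le> (\<Sum>l\<in>routes G s t. \<Sum>e\<in>{e \<in> D. e \<in> l}. x l)"
  proof (rule sum_le_included[where i = "\<lambda>l. l"])
    show "\<forall>l\<in>{l \<in> st_paths G s t. l \<inter> D \<noteq> {}}. \<exists>k\<in>routes G s t. k = l \<and> x l \<le> (\<Sum>e\<in>{e \<in> D. e \<in> k}. x k)"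
    proof (clarsimp)
      fix l assume l: "l \<in> st_paths G s t" "l \<inter> D \<noteq> {}"
      then have l': "l \<in> routes G s t" by (simp add: routes_def)
      have "0 < card {e \<in> D. e \<in> l}" using l(2) finD by (auto simp: card_gt_0_iff)
      then have "1 \<le> real (card {e \<in> D. e \<in> l})" by linarith
      then have "1 * x l \<le> real (card {e \<in> D. e \<in> l}) * x l"
        using feasible_flow_nonneg[OF x l'] by (rule mult_right_mono)
      then show "l \<in> routes G s t \<and> x l \<le> real (card {e \<in> D. e \<in> l}) * x l"
        using l' by simp
    qed
  qed (use finite_st_paths finite_routes feasible_flow_nonneg[OF x] in \<open>auto intro!: sum_nonneg\<close>)
  also have "\<dots> = (\<Sum>e\<in>D. edge_flow G s t x e)"
    unfolding edge_flow_def using finite_routes finD by (rule sum.swap_restrict)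
  finally show ?thesis .
qed

lemma awalk_crosses_cut:
  "\<lbrakk>awalk u p w; u \<in> S; w \<notin> S\<rbrakk> \<Longrightarrow> set p \<inter> cut_set G S \<noteq> {}"
proof (induction p arbitrary: u)
  case Nil
  then show ?case by (auto simp: awalk_Nil_iff)
next
  case (Cons a p)
  then have "a \<in> parcs G" "u = fst a" "awalk (snd a) p w" by (auto simp: awalk_Cons_iff)
  then show ?case using Cons by (cases "snd a \<in> S") (auto simp: cut_set_def split: prod.splits)
qed

lemma st_path_crosses_cut:
  assumes "l \<in> st_paths G s t" "st_cut G s t S T"
  shows "l \<inter> cut_set G S \<noteq> {}"
  using assms awalk_crosses_cut[of s _ t S]
  by (auto simp: st_paths_def st_cut_def apath_def)

lemma cut_set_subset: "cut_set G S \<subseteq> parcs G"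
  by (auto simp: cut_set_def)

lemma flow_value_le_cut_capacity:
  assumes x: "x \<in> feasible_flows G s t c" and cut: "st_cut G s t S T"
  shows "flow_value G s t x \<le> (\<Sum>e\<in>cut_set G S. c e)"
proof -
  have "{l \<in> st_paths G s t. l \<inter> cut_set G S \<noteq> {}} = st_paths G s t"
    using st_path_crosses_cut[OF _ cut] by blast
  then have "flow_value G s t x \<le> (\<Sum>e\<in>cut_set G S. edge_flow G s t x e)"
    using flow_through_edges_le[OF x cut_set_subset[of S]] by (simp add: flow_value_def)
  also have "\<dots> \<le> (\<Sum>e\<in>cut_set G S. c e)"
    using edge_flow_le[OF x] cut_set_subset by (intro sum_mono) auto
  finally show ?thesis .
qed

text \<open>Turns a family of path amounts into an extensional flow that vanishes on loops. It
  serves to realise a path decomposition and, later, to delete the loops of a given flow.\<close>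

lemma path_flow_feasible:
  assumes "\<And>l. 0 \<le> y l"
    and "\<And>e. e \<in> parcs G \<Longrightarrow> (\<Sum>l\<in>{l \<in> st_paths G s t. e \<in> l}. y l) \<le> c e"
  defines "x \<equiv> \<lambda>l\<in>routes G s t. if l \<in> st_paths G s t then y l else 0"
  shows "x \<in> feasible_flows G s t c" "flow_value G s t x = (\<Sum>l\<in>st_paths G s t. y l)"
proof -
  have "edge_flow G s t x e = (\<Sum>l\<in>{l \<in> st_paths G s t. e \<in> l}. y l)" for e
    unfolding edge_flow_def
    by (rule sum.mono_neutral_cong_right) (use finite_routes in \<open>auto simp: x_def routes_def\<close>)
  then show "x \<in> feasible_flows G s t c"
    using assms(1,2) by (auto simp: feasible_flows_def x_def)
  show "flow_value G s t x = (\<Sum>l\<in>st_paths G s t. y l)"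
    unfolding flow_value_def by (rule sum.cong) (auto simp: x_def routes_def)
qed

lemma max_flow_min_cut:
  obtains x S where "x \<in> feasible_flows G s t c" "st_cut G s t S (pverts G - S)"
    "flow_value G s t x = (\<Sum>e\<in>cut_set G S. c e)"
proof -
  have c: "0 \<le> c e" if "e \<in> parcs G" for e
    using capacity_pos[OF that] by simp
  obtain f S where f: "\<And>e. e \<in> parcs G \<Longrightarrow> 0 \<le> f e \<and> f e \<le> c e"
    "edge_flow_of_value G s t f (\<Sum>e\<in>cut_set G S. c e)" and S: "st_cut G s t S (pverts G - S)"
    using max_edge_flow_min_cut[of c s t] c source_in_verts sink_in_verts source_neq_sink by metis
  have "0 \<le> (\<Sum>e\<in>cut_set G S. c e)"
    using c cut_set_subset by (intro sum_nonneg) auto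
  then obtain y where y: "\<And>l. 0 \<le> y l" "(\<Sum>l\<in>st_paths G s t. y l) = (\<Sum>e\<in>cut_set G S. c e)"
    "\<And>e. e \<in> parcs G \<Longrightarrow> (\<Sum>l\<in>{l \<in> st_paths G s t. e \<in> l}. y l) \<le> f e"
    using edge_flow_path_decomposition[OF _ f(2) _ source_in_verts source_neq_sink] f(1) by blast
  have "(\<Sum>l\<in>{l \<in> st_paths G s t. e \<in> l}. y l) \<le> c e" if "e \<in> parcs G" for e
    using y(3)[OF that] f(1)[OF that] by linarith
  from path_flow_feasible[OF y(1) this] show ?thesis
    using that S y(2) by simp
qed

text \<open>A flow and a cut of equal size certify each other through weak duality: the flow is
  maximum, so the \<open>GREATEST\<close> is attained, and the cut is minimum.\<close>

lemma max_flow_value_props: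
  shows min_cuts_nonempty: "min_cuts G s t c \<noteq> {}"
    and min_cut_capacity: "D \<in> min_cuts G s t c \<Longrightarrow> (\<Sum>e\<in>D. c e) = max_flow_value G s t c"
    and flow_value_le_max: "x \<in> feasible_flows G s t c \<Longrightarrow> flow_value G s t x \<le> max_flow_value G s t c"
proof -
  obtain x0 S where x0: "x0 \<in> feasible_flows G s t c" and S: "st_cut G s t S (pverts G - S)"
    and eq: "flow_value G s t x0 = (\<Sum>e\<in>cut_set G S. c e)"
    by (rule max_flow_min_cut)
  have max: "max_flow_value G s t c = (\<Sum>e\<in>cut_set G S. c e)"
    unfolding max_flow_value_def
    using x0 eq flow_value_le_cut_capacity[OF _ S]
    by (intro Greatest_equality) (auto simp flip: eq)
  have least: "(\<Sum>e\<in>cut_set G S. c e) \<le> (\<Sum>e\<in>cut_set G S'. c e)" if "st_cut G s t S' T'" for S' T'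
    using flow_value_le_cut_capacity[OF x0 that] eq by simp
  then have "cut_set G S \<in> min_cuts G s t c" using S by (auto simp: min_cuts_def)
  then show "min_cuts G s t c \<noteq> {}" by blast
  show "(\<Sum>e\<in>D. c e) = max_flow_value G s t c" if "D \<in> min_cuts G s t c"
  proof -
    from that obtain S' T' where D: "D = cut_set G S'" "st_cut G s t S' T'"
      and min: "\<And>S' T'. st_cut G s t S' T' \<Longrightarrow> (\<Sum>e\<in>D. c e) \<le> (\<Sum>e\<in>cut_set G S'. c e)"
      by (auto simp: min_cuts_def)
    show ?thesis using min[OF S] least[OF D(2)] D(1) max by simp
  qed
  show "flow_value G s t x \<le> max_flow_value G s t c" if "x \<in> feasible_flows G s t c"
    using flow_value_le_cut_capacity[OF that S] max by simp
qed

section \<open>Transportation costs\<close>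

lemma transport_cost_by_routes:
  "transport_cost G s t b x = (\<Sum>l\<in>routes G s t. x l * (\<Sum>e\<in>l. b e))"
proof -
  have "transport_cost G s t b x = (\<Sum>e\<in>parcs G. \<Sum>l\<in>{l \<in> routes G s t. e \<in> l}. b e * x l)"
    by (simp add: transport_cost_def edge_flow_def sum_distrib_left)
  also have "\<dots> = (\<Sum>l\<in>routes G s t. \<Sum>e\<in>{e \<in> parcs G. e \<in> l}. b e * x l)"
    using pair_finite_arcs finite_routes by (rule sum.swap_restrict)
  also have "\<dots> = (\<Sum>l\<in>routes G s t. x l * (\<Sum>e\<in>l. b e))"
  proof (rule sum.cong[OF refl])
    fix l assume "l \<in> routes G s t"
    then have "{e \<in> parcs G. e \<in> l} = l" using routes_subset_parcs by blast
    then show "(\<Sum>e\<in>{e \<in> parcs G. e \<in> l}. b e * x l) = x l * (\<Sum>e\<in>l. b e)"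
      by (simp add: sum_distrib_left mult.commute)
  qed
  finally show ?thesis .
qed

lemma route_cost_nonneg: "l \<in> routes G s t \<Longrightarrow> 0 \<le> (\<Sum>e\<in>l. b e)"
  using routes_subset_parcs unit_cost_pos by (intro sum_nonneg less_imp_le) blast

lemma min_path_cost_le: "l \<in> st_paths G s t \<Longrightarrow> min_path_cost G s t b \<le> (\<Sum>e\<in>l. b e)"
  unfolding min_path_cost_def using finite_st_paths by (intro Min_le) auto

lemma min_path_cost_nonneg: "0 \<le> min_path_cost G s t b"
  unfolding min_path_cost_def
  using finite_st_paths st_paths_nonempty route_cost_nonneg
  by (intro Min.boundedI) (auto simp: routes_def)

text \<open>Every unit on a path pays at least \<alpha>, and loops only add cost.\<close>

lemma transport_cost_ge:
  assumes x: "x \<in> feasible_flows G s t c"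
  shows "min_path_cost G s t b * flow_value G s t x \<le> transport_cost G s t b x"
proof -
  have "min_path_cost G s t b * flow_value G s t x = (\<Sum>l\<in>st_paths G s t. x l * min_path_cost G s t b)"
    by (simp add: flow_value_def sum_distrib_left mult.commute)
  also have "\<dots> \<le> (\<Sum>l\<in>st_paths G s t. x l * (\<Sum>e\<in>l. b e))"
    using min_path_cost_le feasible_flow_nonneg[OF x]
    by (intro sum_mono mult_left_mono) (auto simp: routes_def)
  also have "\<dots> \<le> transport_cost G s t b x"
    unfolding transport_cost_by_routes
    using finite_routes feasible_flow_nonneg[OF x] route_cost_nonneg
    by (intro sum_mono2) (auto simp: routes_def)
  finally show ?thesis .
qed

text \<open>The flow of Assumption 1, stripped of its loops, is still a maximum flow and pays
  exactly \<alpha> per unit. A cost minimiser cannot be more expensive.\<close>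

lemma min_cost_max_flow_cost_le:
  assumes cheap: "cheapest_paths_assumption G s t c b" and x: "x \<in> min_cost_max_flows G s t c b"
  shows "transport_cost G s t b x \<le> min_path_cost G s t b * max_flow_value G s t c"
proof -
  obtain z where z: "z \<in> min_cost_max_flows G s t c b"
    "\<And>l. \<lbrakk>l \<in> st_paths G s t; 0 < z l\<rbrakk> \<Longrightarrow> (\<Sum>e\<in>l. b e) = min_path_cost G s t b"
    using cheap by (auto simp: cheapest_paths_assumption_def)
  have z_feas: "z \<in> feasible_flows G s t c" and z_max: "flow_value G s t z = max_flow_value G s t c"
    using z(1) by (auto simp: min_cost_max_flows_def is_arg_min_def)
  \<comment> \<open>The assumption prices only the paths of \<open>z\<close>, so its loops are
    dropped.\<close>
  define y where "y = (\<lambda>l. if l \<in> st_paths G s t then z l else 0)"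
  define w where "w = (\<lambda>l\<in>routes G s t. if l \<in> st_paths G s t then y l else 0)"
  have y_nonneg: "0 \<le> y l" for l
    using feasible_flow_nonneg[OF z_feas] by (auto simp: y_def routes_def)
  have y_le: "(\<Sum>l\<in>{l \<in> st_paths G s t. e \<in> l}. y l) \<le> c e" if "e \<in> parcs G" for e
  proof -
    have "(\<Sum>l\<in>{l \<in> st_paths G s t. e \<in> l}. y l) = (\<Sum>l\<in>{l \<in> st_paths G s t. e \<in> l}. z l)"
      by (rule sum.cong) (auto simp: y_def)
    also have "\<dots> \<le> edge_flow G s t z e"
      unfolding edge_flow_def using finite_routes feasible_flow_nonneg[OF z_feas]
      by (intro sum_mono2) (auto simp: routes_def)
    also have "\<dots> \<le> c e" using edge_flow_le[OF z_feas that] .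
    finally show ?thesis .
  qed
  have w_feas: "w \<in> feasible_flows G s t c" and "flow_value G s t w = (\<Sum>l\<in>st_paths G s t. y l)"
    unfolding w_def using path_flow_feasible[of y] y_nonneg y_le by auto
  then have w_max: "flow_value G s t w = max_flow_value G s t c"
    using z_max by (simp add: y_def flow_value_def)
  have "transport_cost G s t b w = (\<Sum>l\<in>st_paths G s t. min_path_cost G s t b * w l)"
    unfolding transport_cost_by_routes
  proof (rule sum.mono_neutral_cong_right)
    fix l assume l: "l \<in> st_paths G s t"
    show "w l * (\<Sum>e\<in>l. b e) = min_path_cost G s t b * w l"
    proof (cases "0 < z l")
      case True
      then show ?thesis using z(2)[OF l] by simp
    next
      case False
      then have "w l = 0" using l y_nonneg[of l] by (auto simp: w_def y_def routes_def)
      then show ?thesis by simp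
    qed
  qed (use finite_routes in \<open>auto simp: w_def routes_def\<close>)
  also have "\<dots> = min_path_cost G s t b * max_flow_value G s t c"
    by (simp flip: w_max add: flow_value_def sum_distrib_left)
  finally show ?thesis
    using x w_feas w_max by (auto simp: min_cost_max_flows_def is_arg_min_def not_less)
qed

section \<open>Payoffs, lost flow and attack costs\<close>

lemma payoff2_eq: "payoff2 G s t c p2 x \<mu> = p2 * lost_flow x \<mu> - attack_cost G c \<mu>"
proof -
  have "flow_value G s t (\<lambda>l. x l - effective_flow G s t x \<mu> l) = lost_flow x \<mu>"
    unfolding flow_value_def lost_flow_def
    by (rule sum.mono_neutral_cong_right)
      (use finite_st_paths in \<open>auto simp: effective_flow_def routes_def\<close>)
  then show ?thesis by (simp add: payoff2_def)
qed

lemma payoff1_eq: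
  "payoff1 G s t b p1 x \<mu> = p1 * (flow_value G s t x - lost_flow x \<mu>) - transport_cost G s t b x"
proof -
  have "(\<Sum>l\<in>st_paths G s t. x l - effective_flow G s t x \<mu> l) = lost_flow x \<mu>"
    unfolding lost_flow_def
    by (rule sum.mono_neutral_cong_right)
      (use finite_st_paths in \<open>auto simp: effective_flow_def routes_def\<close>)
  then have "flow_value G s t (effective_flow G s t x \<mu>) = flow_value G s t x - lost_flow x \<mu>"
    by (simp add: flow_value_def sum_subtractf)
  then show ?thesis by (simp add: payoff1_def)
qed

text \<open>Once the loss of a flow in \<Omega> is known to equal the attack cost, the second bound
  limits that cost by \<Theta> and the third forces saturation.\<close>

lemma lost_flow_bounds:
  assumes x: "x \<in> feasible_flows G s t c"
  shows "0 \<le> lost_flow x \<mu>" "lost_flow x \<mu> \<le> flow_value G s t x"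
    "lost_flow x \<mu> \<le> (\<Sum>e\<in>{e \<in> parcs G. \<mu> e = 1}. edge_flow G s t x e)"
proof -
  show "0 \<le> lost_flow x \<mu>"
    unfolding lost_flow_def using feasible_flow_nonneg[OF x] by (intro sum_nonneg) (auto simp: routes_def)
  show "lost_flow x \<mu> \<le> flow_value G s t x"
    unfolding lost_flow_def flow_value_def
    using feasible_flow_nonneg[OF x] finite_st_paths by (intro sum_mono2) (auto simp: routes_def)
  have "{l \<in> st_paths G s t. \<exists>e\<in>l. \<mu> e = 1} =
      {l \<in> st_paths G s t. l \<inter> {e \<in> parcs G. \<mu> e = 1} \<noteq> {}}"
    using st_path_subset_parcs[of _ s t] by blast
  then show "lost_flow x \<mu> \<le> (\<Sum>e\<in>{e \<in> parcs G. \<mu> e = 1}. edge_flow G s t x e)"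
    unfolding lost_flow_def using flow_through_edges_le[OF x, of "{e \<in> parcs G. \<mu> e = 1}"] by simp
qed

lemma attack_cost_eq:
  assumes "\<mu> \<in> attacks G"
  shows "attack_cost G c \<mu> = (\<Sum>e\<in>{e \<in> parcs G. \<mu> e = 1}. c e)"
  unfolding attack_cost_def
  by (rule sum.mono_neutral_cong_right)
    (use assms pair_finite_arcs in \<open>auto simp: attacks_def PiE_iff\<close>)

lemma finite_attacks: "finite (attacks G)"
  unfolding attacks_def using pair_finite_arcs by (intro finite_PiE) auto

lemma attack_on_attacks: "attack_on G D \<in> attacks G"
  by (auto simp: attack_on_def attacks_def indicator_def)

lemma attack_cost_attack_on: "D \<subseteq> parcs G \<Longrightarrow> attack_cost G c (attack_on G D) = (\<Sum>e\<in>D. c e)"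
  unfolding attack_cost_def
  by (rule sum.mono_neutral_cong_right)
    (use pair_finite_arcs in \<open>auto simp: attack_on_def indicator_def\<close>)

lemma lost_flow_no_attack: "lost_flow x (attack_on G {}) = 0"
proof -
  \<comment> \<open>Off the arcs the restricted attack is \<open>undefined\<close>, which might be
    1, so it matters that paths consist of arcs.\<close>
  have "\<not> (\<exists>e\<in>l. attack_on G {} e = 1)" if "l \<in> st_paths G s t" for l
    using st_path_subset_parcs[OF that] by (auto simp: attack_on_def)
  then show ?thesis unfolding lost_flow_def by (intro sum.neutral) auto
qed

text \<open>Every path crosses the cut, so nothing gets through.\<close>

lemma lost_flow_min_cut:
  assumes "D \<in> min_cuts G s t c"
  shows "lost_flow x (attack_on G D) = flow_value G s t x"
proof -
  obtain S T where D: "D = cut_set G S" "st_cut G s t S T"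
    using assms by (auto simp: min_cuts_def)
  have "\<exists>e\<in>l. attack_on G D e = 1" if "l \<in> st_paths G s t" for l
    using st_path_crosses_cut[OF that D(2)] cut_set_subset[of S]
    by (auto simp: D(1) attack_on_def indicator_def)
  then have "{l \<in> st_paths G s t. \<exists>e\<in>l. attack_on G D e = 1} = st_paths G s t" by blast
  then show ?thesis by (simp add: lost_flow_def flow_value_def)
qed

text \<open>Data for the deviation in which player 1 sends nothing.\<close>

lemma zero_flow:
  defines "x \<equiv> \<lambda>l\<in>routes G s t. 0"
  shows "x \<in> feasible_flows G s t c" "flow_value G s t x = 0" "transport_cost G s t b x = 0"
    "lost_flow x = (\<lambda>_. 0)"
proof -
  have x: "x l = 0" if "l \<in> routes G s t" for l using that by (simp add: x_def)
  have "edge_flow G s t x e = 0" for e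
    unfolding edge_flow_def by (rule sum.neutral) (auto simp: x)
  then show "x \<in> feasible_flows G s t c" "transport_cost G s t b x = 0"
    using capacity_pos by (auto simp: feasible_flows_def x_def transport_cost_def less_imp_le)
  show "flow_value G s t x = 0" "lost_flow x = (\<lambda>_. 0)"
    unfolding flow_value_def lost_flow_def fun_eq_iff
    by (auto intro!: sum.neutral simp: x routes_def)
qed

end

section \<open>Equilibria\<close>

lemma integrable_measure_pmf_bounded:
  fixes f :: "'a \<Rightarrow> real"
  assumes "\<And>x. x \<in> set_pmf M \<Longrightarrow> 0 \<le> f x \<and> f x \<le> B"
  shows "integrable (measure_pmf M) f"
  by (rule measure_pmf.integrable_const_bound[where B = B]) (use assms in \<open>auto simp: AE_measure_pmf_iff\<close>)

text \<open>
  \<open>F\<close>, \<open>A\<close>, \<open>K\<close>, \<open>C\<close> are the expected flow, lost flow, transportation cost and attack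
  cost at an equilibrium; \<open>L\<close> and \<open>k\<close> are the expected loss and the cost of a flow in \<open>\<Omega>\<close>.
  The deviation hypotheses enter with the weights of the special equilibrium, multiplied by
  \<open>p1 * p2\<close>.
\<close>

lemma payoff_exchange:
  fixes F A K C L k \<theta> \<alpha> p1 p2 :: real
  assumes \<alpha>: "0 \<le> \<alpha>" "\<alpha> < p1" and p2: "1 < p2"
    and none1: "0 \<le> p1 * (F - A) - K"
    and flow1: "p1 * (\<theta> - L) - k \<le> p1 * (F - A) - K"
    and none2: "0 \<le> p2 * A - C"
    and cut2: "p2 * F - \<theta> \<le> p2 * A - C"
    and K: "\<alpha> * F \<le> K" and k: "k \<le> \<alpha> * \<theta>"
  shows "C \<le> L"
proof -
  have 1: "0 \<le> (p1 - \<alpha>) * F - p1 * A"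
    using none1 K by (simp add: algebra_simps)
  have 2: "(p1 - \<alpha>) * \<theta> - p1 * L \<le> (p1 - \<alpha>) * F - p1 * A"
    using flow1 K k by (simp add: algebra_simps)
  \<comment> \<open>The weights \<alpha> and \<open>p1 - \<alpha>\<close> are \<open>p1\<close>
    times the probabilities of no attack and of the minimum cut.\<close>
  have 3: "\<alpha> * 0 + (p1 - \<alpha>) * (p2 * F - \<theta>) \<le> \<alpha> * (p2 * A - C) + (p1 - \<alpha>) * (p2 * A - C)"
    using \<alpha> none2 cut2 by (intro add_mono mult_left_mono) auto
  \<comment> \<open>Up to the factor \<open>p2\<close>, sending nothing has weight
    \<open>p2 - 1\<close> and the flow in \<Omega> has weight 1, with which 2 enters.\<close>
  have 4: "(p2 - 1) * 0 \<le> (p2 - 1) * ((p1 - \<alpha>) * F - p1 * A)"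
    using p2 1 by (intro mult_left_mono) auto
  \<comment> \<open>Write \<open>X\<close> for \<open>(p1 - \<alpha>) * F - p1 * A\<close>. Then 3
    says that \<open>p1 * C\<close> is at most \<open>(p1 - \<alpha>) * \<theta> - p2 * X\<close>;
    by 2 this is at most \<open>p1 * L - (p2 - 1) * X\<close>, and 4 removes the last term.\<close>
  have "p1 * C \<le> p1 * L"
    using 2 3 4 by (simp add: algebra_simps)
  then show ?thesis using \<alpha> by simp
qed

section \<open>Attacks in the support of an equilibrium\<close>

context network
begin

text \<open>Four pure deviations suffice: sending nothing, sending \<open>x\<close>, attacking
  nothing and attacking a minimum cut. That none is profitable feeds
  \<open>payoff_exchange\<close>.\<close>

lemma equilibrium_loss_ge_attack_cost:
  assumes cheap: "cheapest_paths_assumption G s t c b"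
    and p1: "min_path_cost G s t b < p1" and p2: "1 < p2"
    and eq: "(\<sigma>1, \<sigma>2) \<in> routing_game_equilibria G s t c b p1 p2"
    and x: "x \<in> min_cost_max_flows G s t c b"
  shows "measure_pmf.expectation \<sigma>2 (attack_cost G c) \<le> measure_pmf.expectation \<sigma>2 (lost_flow x)"
proof -
  let ?E1 = "measure_pmf.expectation \<sigma>1" and ?E2 = "measure_pmf.expectation \<sigma>2"
  let ?\<theta> = "max_flow_value G s t c"
  have supp1: "y \<in> feasible_flows G s t c" if "y \<in> set_pmf \<sigma>1" for y
    using eq that by (auto simp: routing_game_equilibria_def mixed_nash_equilibria_def mixed_strategies_def)
  have supp2: "set_pmf \<sigma>2 \<subseteq> attacks G"
    using eq by (auto simp: routing_game_equilibria_def mixed_nash_equilibria_def mixed_strategies_def)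
  \<comment> \<open>There are finitely many attacks, so every expectation over
    \<open>\<sigma>2\<close> exists. \<open>\<sigma>1\<close> may have infinite support, and
    integrability over it rests on the uniform bounds below.\<close>
  have int2: "integrable (measure_pmf \<sigma>2) f" for f :: "'v attack \<Rightarrow> real"
    using finite_subset[OF supp2 finite_attacks] by (rule integrable_measure_pmf_finite)
  have E2_loss: "0 \<le> ?E2 (lost_flow y) \<and> ?E2 (lost_flow y) \<le> ?\<theta>" if "y \<in> set_pmf \<sigma>1" for y
  proof
    note y = supp1[OF that]
    show "0 \<le> ?E2 (lost_flow y)" using lost_flow_bounds(1)[OF y] by simp
    have "?E2 (lost_flow y) \<le> ?E2 (\<lambda>_. ?\<theta>)"
      using lost_flow_bounds(2)[OF y] flow_value_le_max[OF y]
      by (intro integral_mono int2) (meson order_trans)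
    then show "?E2 (lost_flow y) \<le> ?\<theta>" by simp
  qed
  have int_loss: "integrable (measure_pmf \<sigma>1) (\<lambda>y. ?E2 (lost_flow y))"
    by (rule integrable_measure_pmf_bounded) (rule E2_loss)
  have int_flow: "integrable (measure_pmf \<sigma>1) (flow_value G s t)"
  proof (rule integrable_measure_pmf_bounded)
    fix y assume "y \<in> set_pmf \<sigma>1"
    note y = supp1[OF this]
    show "0 \<le> flow_value G s t y \<and> flow_value G s t y \<le> ?\<theta>"
      \<comment> \<open>The value is nonnegative because it dominates the nonnegative loss under any
        attack, here the constant 0.\<close>
      using lost_flow_bounds(1,2)[OF y, of "\<lambda>_. 0"] flow_value_le_max[OF y] by linarith
  qed
  have int_cost: "integrable (measure_pmf \<sigma>1) (transport_cost G s t b)"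
  proof (rule integrable_measure_pmf_bounded)
    fix y assume "y \<in> set_pmf \<sigma>1"
    note y = supp1[OF this]
    show "0 \<le> transport_cost G s t b y \<and> transport_cost G s t b y \<le> (\<Sum>e\<in>parcs G. b e * c e)"
      unfolding transport_cost_def
      using edge_flow_nonneg[OF y] edge_flow_le[OF y] unit_cost_pos
      by (auto intro!: sum_nonneg sum_mono mult_left_mono mult_nonneg_nonneg simp: less_imp_le)
  qed
  have E2_payoff1: "?E2 (payoff1 G s t b p1 y) =
      p1 * (flow_value G s t y - ?E2 (lost_flow y)) - transport_cost G s t b y" for y
    by (simp add: payoff1_eq[abs_def] int2)
  have E2_payoff2: "?E2 (payoff2 G s t c p2 y) = p2 * ?E2 (lost_flow y) - ?E2 (attack_cost G c)" for y
    by (simp add: payoff2_eq[abs_def] int2)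
  have U1: "expected (payoff1 G s t b p1) \<sigma>1 \<sigma>2 =
      p1 * (?E1 (flow_value G s t) - ?E1 (\<lambda>y. ?E2 (lost_flow y))) - ?E1 (transport_cost G s t b)"
    unfolding expected_def E2_payoff1 using int_loss int_flow int_cost by simp
  have U2: "expected (payoff2 G s t c p2) \<sigma>1 \<sigma>2 =
      p2 * ?E1 (\<lambda>y. ?E2 (lost_flow y)) - ?E2 (attack_cost G c)"
    unfolding expected_def E2_payoff2 using int_loss by simp
  have dev1: "p1 * (flow_value G s t y - ?E2 (lost_flow y)) - transport_cost G s t b y
      \<le> expected (payoff1 G s t b p1) \<sigma>1 \<sigma>2" if "y \<in> feasible_flows G s t c" for y
  proof -
    have "return_pmf y \<in> mixed_strategies (feasible_flows G s t c)"
      using that by (simp add: mixed_strategies_def)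
    then have "expected (payoff1 G s t b p1) (return_pmf y) \<sigma>2 \<le> expected (payoff1 G s t b p1) \<sigma>1 \<sigma>2"
      using eq by (auto simp: routing_game_equilibria_def mixed_nash_equilibria_def)
    then show ?thesis by (simp add: expected_def[of _ "return_pmf y"] E2_payoff1)
  qed
  have dev2: "?E1 (\<lambda>y. p2 * lost_flow y \<mu> - attack_cost G c \<mu>)
      \<le> expected (payoff2 G s t c p2) \<sigma>1 \<sigma>2" if "\<mu> \<in> attacks G" for \<mu>
  proof -
    have "return_pmf \<mu> \<in> mixed_strategies (attacks G)"
      using that by (simp add: mixed_strategies_def)
    then have "expected (payoff2 G s t c p2) \<sigma>1 (return_pmf \<mu>) \<le> expected (payoff2 G s t c p2) \<sigma>1 \<sigma>2"
      using eq by (auto simp: routing_game_equilibria_def mixed_nash_equilibria_def)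
    then show ?thesis by (simp add: expected_def[of _ _ "return_pmf \<mu>"] payoff2_eq)
  qed
  obtain D where D: "D \<in> min_cuts G s t c" using min_cuts_nonempty by blast
  have "D \<subseteq> parcs G" using D by (auto simp: min_cuts_def cut_set_def)
  then have cost_D: "attack_cost G c (attack_on G D) = ?\<theta>"
    using attack_cost_attack_on min_cut_capacity[OF D] by simp
  have x_feas: "x \<in> feasible_flows G s t c" and x_max: "flow_value G s t x = ?\<theta>"
    using x by (auto simp: min_cost_max_flows_def is_arg_min_def)
  have "min_path_cost G s t b * ?E1 (flow_value G s t) = ?E1 (\<lambda>y. min_path_cost G s t b * flow_value G s t y)"
    by simp
  also have "\<dots> \<le> ?E1 (transport_cost G s t b)"
    using int_flow int_cost transport_cost_ge supp1
    by (intro integral_mono_AE) (auto simp: AE_measure_pmf_iff)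
  finally have K: "min_path_cost G s t b * ?E1 (flow_value G s t) \<le> ?E1 (transport_cost G s t b)" .
  show ?thesis
  proof (rule payoff_exchange)
    show "0 \<le> min_path_cost G s t b" by (rule min_path_cost_nonneg)
    show "min_path_cost G s t b < p1" "1 < p2" by fact+
    show "0 \<le> p1 * (?E1 (flow_value G s t) - ?E1 (\<lambda>y. ?E2 (lost_flow y))) - ?E1 (transport_cost G s t b)"
      using dev1[OF zero_flow(1)] by (simp add: U1 zero_flow)
    show "p1 * (?\<theta> - ?E2 (lost_flow x)) - transport_cost G s t b x
        \<le> p1 * (?E1 (flow_value G s t) - ?E1 (\<lambda>y. ?E2 (lost_flow y))) - ?E1 (transport_cost G s t b)"
      using dev1[OF x_feas] by (simp add: U1 x_max)
    show "0 \<le> p2 * ?E1 (\<lambda>y. ?E2 (lost_flow y)) - ?E2 (attack_cost G c)"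
      using dev2[OF attack_on_attacks[of "{}"]]
      by (simp add: U2 lost_flow_no_attack attack_cost_attack_on)
    show "p2 * ?E1 (flow_value G s t) - ?\<theta> \<le> p2 * ?E1 (\<lambda>y. ?E2 (lost_flow y)) - ?E2 (attack_cost G c)"
      using dev2[OF attack_on_attacks[of D]] int_flow
      by (simp add: U2 lost_flow_min_cut[OF D] cost_D)
    show "min_path_cost G s t b * ?E1 (flow_value G s t) \<le> ?E1 (transport_cost G s t b)" by (rule K)
    show "transport_cost G s t b x \<le> min_path_cost G s t b * ?\<theta>"
      using cheap x by (rule min_cost_max_flow_cost_le)
  qed
qed

text \<open>Capacities make the loss of \<open>x\<close> at most the cost for every single attack,
  while in expectation the reverse inequality holds. Hence the two agree wherever
  \<open>\<sigma>2\<close> has mass.\<close>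

lemma equilibrium_attack_loss_eq_cost:
  assumes cheap: "cheapest_paths_assumption G s t c b"
    and p1: "min_path_cost G s t b < p1" and p2: "1 < p2"
    and eq: "(\<sigma>1, \<sigma>2) \<in> routing_game_equilibria G s t c b p1 p2"
    and \<mu>: "\<mu> \<in> set_pmf \<sigma>2"
    and x: "x \<in> min_cost_max_flows G s t c b"
  shows "attack_cost G c \<mu> = lost_flow x \<mu>"
    and "attack_cost G c \<mu> \<le> max_flow_value G s t c"
    and "\<lbrakk>e \<in> parcs G; \<mu> e = 1\<rbrakk> \<Longrightarrow> edge_flow G s t x e = c e"
proof -
  have supp2: "set_pmf \<sigma>2 \<subseteq> attacks G"
    using eq by (auto simp: routing_game_equilibria_def mixed_nash_equilibria_def mixed_strategies_def)
  then have fin: "finite (set_pmf \<sigma>2)" using finite_attacks finite_subset by blast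
  have x_feas: "x \<in> feasible_flows G s t c" and x_max: "flow_value G s t x = max_flow_value G s t c"
    using x by (auto simp: min_cost_max_flows_def is_arg_min_def)
  have edges: "(\<Sum>e\<in>{e \<in> parcs G. \<nu> e = 1}. edge_flow G s t x e) \<le> attack_cost G c \<nu>"
    if "\<nu> \<in> attacks G" for \<nu>
    unfolding attack_cost_eq[OF that] using edge_flow_le[OF x_feas] by (intro sum_mono) auto
  have le: "lost_flow x \<nu> \<le> attack_cost G c \<nu>" if "\<nu> \<in> set_pmf \<sigma>2" for \<nu>
    using lost_flow_bounds(3)[OF x_feas, of \<nu>] edges[of \<nu>] that supp2 by auto
  have "(\<Sum>\<nu>\<in>set_pmf \<sigma>2. pmf \<sigma>2 \<nu> * attack_cost G c \<nu>) \<le> (\<Sum>\<nu>\<in>set_pmf \<sigma>2. pmf \<sigma>2 \<nu> * lost_flow x \<nu>)"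
    using equilibrium_loss_ge_attack_cost[OF cheap p1 p2 eq x]
    by (simp add: integral_measure_pmf[OF fin])
  then have "(\<Sum>\<nu>\<in>set_pmf \<sigma>2. pmf \<sigma>2 \<nu> * (attack_cost G c \<nu> - lost_flow x \<nu>)) \<le> 0"
    by (simp add: right_diff_distrib sum_subtractf)
  moreover have nonneg: "0 \<le> pmf \<sigma>2 \<nu> * (attack_cost G c \<nu> - lost_flow x \<nu>)" if "\<nu> \<in> set_pmf \<sigma>2" for \<nu>
    using le[OF that] by simp
  ultimately have "(\<Sum>\<nu>\<in>set_pmf \<sigma>2. pmf \<sigma>2 \<nu> * (attack_cost G c \<nu> - lost_flow x \<nu>)) = 0"
    by (intro antisym sum_nonneg) auto
  then have "pmf \<sigma>2 \<mu> * (attack_cost G c \<mu> - lost_flow x \<mu>) = 0"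
    using sum_nonneg_eq_0_iff[OF fin, of "\<lambda>\<nu>. pmf \<sigma>2 \<nu> * (attack_cost G c \<nu> - lost_flow x \<nu>)"]
      nonneg \<mu> by blast
  then show loss: "attack_cost G c \<mu> = lost_flow x \<mu>"
    using \<mu> by (auto simp: set_pmf_iff)
  then show "attack_cost G c \<mu> \<le> max_flow_value G s t c"
    using lost_flow_bounds(2)[OF x_feas, of \<mu>] x_max by simp
  have att: "\<mu> \<in> attacks G" using \<mu> supp2 by blast
  \<comment> \<open>The edge flow on the attacked edges is squeezed between the loss and the attack
    cost, which coincide; termwise domination by \<open>c\<close> then gives equality on each
    edge.\<close>
  have sum_eq: "(\<Sum>e\<in>{e \<in> parcs G. \<mu> e = 1}. edge_flow G s t x e) = (\<Sum>e\<in>{e \<in> parcs G. \<mu> e = 1}. c e)"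
    using edges[OF att] lost_flow_bounds(3)[OF x_feas, of \<mu>] loss attack_cost_eq[OF att] by linarith
  show "edge_flow G s t x e = c e" if "e \<in> parcs G" "\<mu> e = 1"
    by (rule sum_mono_inv[OF sum_eq]) (use that edge_flow_le[OF x_feas] pair_finite_arcs in simp_all)
qed

end

theorem proposition4:
  fixes G :: "'v pair_pre_digraph" and s t :: 'v and c b :: "'v edge \<Rightarrow> real" and p1 p2 :: real
    and \<sigma>1 :: "'v flow pmf" and \<sigma>2 :: "'v attack pmf" and \<mu> :: "'v attack"
  assumes "network G s t c b"
    and "cheapest_paths_assumption G s t c b"
    and "p1 > min_path_cost G s t b"
    and "p2 > 1"
    and "(\<sigma>1, \<sigma>2) \<in> routing_game_equilibria G s t c b p1 p2"
    and "\<mu> \<in> set_pmf \<sigma>2"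
  shows "(\<forall>D\<in>min_cuts G s t c.
            attack_cost G c \<mu> \<le> attack_cost G c (attack_on G D) \<and>
            attack_cost G c (attack_on G D) = max_flow_value G s t c) \<and>
         (\<forall>e\<in>parcs G. \<mu> e = 1 \<longrightarrow>
            (\<forall>x\<in>min_cost_max_flows G s t c b. edge_flow G s t x e = c e))"
proof -
  interpret network G s t c b by fact
  note support = equilibrium_attack_loss_eq_cost[OF assms(2-6)]
  \<comment> \<open>The bound on the attack cost does not mention a flow but is obtained through one
    in \<Omega>, which Assumption 1 supplies.\<close>
  obtain x where x: "x \<in> min_cost_max_flows G s t c b"
    using assms(2) by (auto simp: cheapest_paths_assumption_def)
  have "attack_cost G c (attack_on G D) = max_flow_value G s t c" if "D \<in> min_cuts G s t c" for D
  proof -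
    have "D \<subseteq> parcs G" using that by (auto simp: min_cuts_def cut_set_def)
    then show ?thesis using attack_cost_attack_on min_cut_capacity[OF that] by simp
  qed
  then show ?thesis using support(2)[OF x] support(3) by auto
qed

end
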